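(* Fix the observed data $x$, $\epsilon\in(0,1)$ and $\gamma\in[0,1]$, and let $RB_\Psi(\cdot\,|\,x)$, $r$, $\delta$, $C_{\Psi,\gamma}(x)$ and $\gamma^{*}(x)=\Pi_\Psi(C_{\Psi,\gamma}(x)\,|\,x)$ be as defined in the context. The following hold. (i) Among all sets $A\subset\Psi$ satisfying $\Pi_\Psi(A\,|\,x)\le\gamma^{*}(x)$ and $r(A)=r(\Psi)$, the set $C_{\Psi,\gamma}(x)$ minimizes $\delta(A)$. (ii) Among all sets $A\subset\Psi$ satisfying $\Pi_\Psi(A\,|\,x)\ge\gamma^{*}(x)$ and $r(A^{c})=r(\Psi)$, the set $C_{\Psi,1-\gamma^{*}(x)}^{c}(x)$ (the complement of $C_{\Psi,1-\gamma^{*}(x)}(x)$) minimizes $\delta(A)$. (iii) When $\gamma^{*}(x)=\gamma\ge 1/2$, then among all sets $A\subset\Psi$ satisfying $\Pi_\Psi(A\,|\,x)=\gamma$, the set $C_{\Psi,\gamma}(x)$ minimizes $\delta(A)$.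
   Context: Setting. $\{f_\theta:\theta\in\Theta\}$ is a statistical model of probability densities with respect to volume measure $\mu$ on a sample space $\mathcal X$ (volume measure on a discrete set is counting measure). $\Pi$ is a proper prior on $\Theta$ with density $\pi$ with respect to volume measure $\nu$. $\Psi:\Theta\to\Psi$ is an onto map (the same symbol denotes the map and its range), $\psi=\Psi(\theta)$ is the parameter of interest, $\Pi_\Psi$ is the marginal prior of $\psi$, and $\Pi(\cdot\,|\,\psi)$ is the conditional prior of $\theta$ given $\Psi(\theta)=\psi$, concentrated on $\Psi^{-1}\{\psi\}$. The conditional prior predictive density of $x$ given $\psi$ is $m(x\,|\,\psi)=\int_{\Psi^{-1}\{\psi\}}f_\theta(x)\,\Pi(d\theta\,|\,\psi)$, and the prior predictive density is $m(x)=\int_\Psi m(x\,|\,\psi)\,\Pi_\Psi(d\psi)$, with $m(x)>0$. The posterior of $\psi$ is $\Pi_\Psi(A\,|\,x)=\int_A (m(x\,|\,\psi)/m(x))\,\Pi_\Psi(d\psi)$. The relative belief ratio is $RB_\Psi(\psi\,|\,x)=m(x\,|\,\psi)/m(x)$ (equal to the posterior density of $\psi$ divided by the prior density of $\psi$). It is assumed that $RB_\Psi(\cdot\,|\,x)$ has a unique maximizer $\psi(x)$. For $A\subset\Psi$ put $r(A)=\sup_{\psi\in A}RB_\Psi(\psi\,|\,x)$, so $r(\Psi)=RB_\Psi(\psi(x)\,|\,x)$ and one and only one of $r(A),r(A^{c})$ equals $r(\Psi)$. Relative belief credible regions: for $\gamma\in[0,1]$, $C_{\Psi,\gamma}(x)=\{\psi:RB_\Psi(\psi\,|\,x)\ge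 c_{\Psi,\gamma}(x)\}$, where $c_{\Psi,\gamma}(x)=\inf\{k:\Pi_\Psi(RB_\Psi(\psi\,|\,x)\le k\,|\,x)\ge 1-\gamma\}$. $\epsilon$-contaminated priors: for a probability measure $Q$ on $\Psi$, consider the prior for $\theta$ with marginal $(1-\epsilon)\Pi_\Psi+\epsilon Q$ for $\psi$ and unchanged conditional priors $\Pi(\cdot\,|\,\psi)$ of $\theta$ given $\psi$. Its posterior for $\psi$ is $$\Pi_\Psi^{\epsilon}(A\,|\,x)=\frac{(1-\epsilon)\int_A m(x\,|\,\psi)\,\Pi_\Psi(d\psi)+\epsilon\int_A m(x\,|\,\psi)\,Q(d\psi)}{(1-\epsilon)\int_\Psi m(x\,|\,\psi)\,\Pi_\Psi(d\psi)+\epsilon\int_\Psi m(x\,|\,\psi)\,Q(d\psi)}.$$ Define $\delta(A)=\sup_Q\Pi_\Psi^{\epsilon}(A\,|\,x)-\inf_Q\Pi_\Psi^{\epsilon}(A\,|\,x)$, the supremum and infimum being over all probability measures $Q$ on $\Psi$.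
   Formalization: (i) is proved when γ*=γ or every value of RB lies in the support of its prior distribution; in (ii) δ of the stated set is ≤ δ(A) always, but its membership in the class is claimed only when Π_Ψ(C_{1-γ*}|x)=1-γ*. Sets A are measurable. *)

theory Defs
  imports "HOL-Probability.Probability"
begin

definition prior :: "'t measure \<Rightarrow> ('t \<Rightarrow> real) \<Rightarrow> 't measure" where
  "prior \<nu> \<pi> = density \<nu> (\<lambda>\<theta>. ennreal (\<pi> \<theta>))"

definition marginal_prior ::
  "'t measure \<Rightarrow> ('t \<Rightarrow> real) \<Rightarrow> ('t \<Rightarrow> 'p) \<Rightarrow> 'p measure \<Rightarrow> 'p measure" where
  "marginal_prior \<nu> \<pi> \<Psi> N = distr (prior \<nu> \<pi>) N \<Psi>"

text \<open>
  The volume measures \<open>\<mu>\<close> and \<open>\<nu>\<close> are arbitrary sigma-finite measures. The range of \<open>\<Psi>\<close> is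
  \<open>space N\<close>; only the sigma-algebra of \<open>N\<close> matters. The Markov kernel \<open>K\<close> is the conditional
  prior of \<open>\<theta>\<close> given \<open>\<psi>\<close>: \<open>K \<psi>\<close> lives on the fibre of \<open>\<Psi>\<close> over \<open>\<psi>\<close>, and mixing \<open>K\<close> over the
  marginal prior gives back the prior.
\<close>

locale bayes_model =
  fixes \<mu> :: "'x measure" and \<nu> :: "'t measure" and N :: "'p measure"
    and f :: "'t \<Rightarrow> 'x \<Rightarrow> real" and \<pi> :: "'t \<Rightarrow> real"
    and \<Psi> :: "'t \<Rightarrow> 'p" and K :: "'p \<Rightarrow> 't measure"
  assumes sigma_finite_sample: "sigma_finite_measure \<mu>"
    and sigma_finite_param: "sigma_finite_measure \<nu>"
    and model_measurable: "(\<lambda>(\<theta>, x). f \<theta> x) \<in> borel_measurable (\<nu> \<Otimes>\<^sub>M \<mu>)"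
    and model_nonneg: "\<And>\<theta> x. \<theta> \<in> space \<nu> \<Longrightarrow> x \<in> space \<mu> \<Longrightarrow> 0 \<le> f \<theta> x"
    and model_density: "\<And>\<theta>. \<theta> \<in> space \<nu> \<Longrightarrow> (\<integral>\<^sup>+ x. ennreal (f \<theta> x) \<partial>\<mu>) = 1"
    and prior_measurable: "\<pi> \<in> borel_measurable \<nu>"
    and prior_nonneg: "\<And>\<theta>. \<theta> \<in> space \<nu> \<Longrightarrow> 0 \<le> \<pi> \<theta>"
    and prior_density: "(\<integral>\<^sup>+ \<theta>. ennreal (\<pi> \<theta>) \<partial>\<nu>) = 1"
    and param_measurable: "\<Psi> \<in> measurable \<nu> N"
    and param_onto: "\<Psi> ` space \<nu> = space N"
    and kernel: "K \<in> measurable N (prob_algebra \<nu>)"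
    and kernel_fibre: "\<And>\<psi>. \<psi> \<in> space N \<Longrightarrow> AE \<theta> in K \<psi>. \<Psi> \<theta> = \<psi>"
    and disintegration: "prior \<nu> \<pi> = marginal_prior \<nu> \<pi> \<Psi> N \<bind> K"

definition cond_predictive ::
  "('t \<Rightarrow> 'x \<Rightarrow> real) \<Rightarrow> ('p \<Rightarrow> 't measure) \<Rightarrow> 'x \<Rightarrow> 'p \<Rightarrow> real" where
  "cond_predictive f K x \<psi> = (LINT \<theta>|K \<psi>. f \<theta> x)"

text \<open>
  From here on the data \<open>x\<close> are fixed: \<open>P\<close> stands for the marginal prior of \<open>\<psi>\<close> and \<open>m\<close> for the
  function taking \<open>\<psi>\<close> to the conditional prior predictive density of \<open>x\<close> given \<open>\<psi>\<close>.
\<close>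

definition predictive :: "'p measure \<Rightarrow> ('p \<Rightarrow> real) \<Rightarrow> real" where
  "predictive P m = (LINT \<psi>|P. m \<psi>)"

definition rel_belief :: "'p measure \<Rightarrow> ('p \<Rightarrow> real) \<Rightarrow> 'p \<Rightarrow> real" where
  "rel_belief P m \<psi> = m \<psi> / predictive P m"

definition posterior :: "'p measure \<Rightarrow> ('p \<Rightarrow> real) \<Rightarrow> 'p set \<Rightarrow> real" where
  "posterior P m A = (LINT \<psi>:A|P. m \<psi> / predictive P m)"

text \<open>
  Suprema and infima of relative belief ratios and of thresholds are taken in the extended reals,
  so that the supremum over the empty set is \<open>-\<infinity>\<close> and the threshold for \<open>\<gamma> = 1\<close> is \<open>-\<infinity>\<close>
  (the credible region is then everything); in the type of reals both would be junk values.
\<close>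

definition rb_sup :: "'p measure \<Rightarrow> ('p \<Rightarrow> real) \<Rightarrow> 'p set \<Rightarrow> ereal" where
  "rb_sup P m A = (SUP \<psi>\<in>A. ereal (rel_belief P m \<psi>))"

definition rb_threshold :: "'p measure \<Rightarrow> ('p \<Rightarrow> real) \<Rightarrow> real \<Rightarrow> ereal" where
  "rb_threshold P m \<gamma> =
     Inf {ereal k | k. posterior P m {\<psi> \<in> space P. rel_belief P m \<psi> \<le> k} \<ge> 1 - \<gamma>}"

definition rb_region :: "'p measure \<Rightarrow> ('p \<Rightarrow> real) \<Rightarrow> real \<Rightarrow> 'p set" where
  "rb_region P m \<gamma> = {\<psi> \<in> space P. ereal (rel_belief P m \<psi>) \<ge> rb_threshold P m \<gamma>}"

definition contaminated_posterior ::
  "real \<Rightarrow> 'p measure \<Rightarrow> ('p \<Rightarrow> real) \<Rightarrow> 'p measure \<Rightarrow> 'p set \<Rightarrow> real" where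
  "contaminated_posterior \<epsilon> P m Q A =
     ((1 - \<epsilon>) * (LINT \<psi>:A|P. m \<psi>) + \<epsilon> * (LINT \<psi>:A|Q. m \<psi>)) /
     ((1 - \<epsilon>) * (LINT \<psi>|P. m \<psi>) + \<epsilon> * (LINT \<psi>|Q. m \<psi>))"

definition contaminations :: "'p measure \<Rightarrow> 'p measure set" where
  "contaminations P = {Q. prob_space Q \<and> sets Q = sets P}"

definition post_range :: "real \<Rightarrow> 'p measure \<Rightarrow> ('p \<Rightarrow> real) \<Rightarrow> 'p set \<Rightarrow> real" where
  "post_range \<epsilon> P m A =
     (SUP Q\<in>contaminations P. contaminated_posterior \<epsilon> P m Q A) -
     (INF Q\<in>contaminations P. contaminated_posterior \<epsilon> P m Q A)"

text \<open>
  Every value of the relative belief ratio lies in the support of its prior distribution. This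
  holds when \<open>\<psi>\<close> is discrete with positive prior probabilities, and when the ratio is continuous
  and the prior charges every nonempty open set. It excludes values attained only on prior-null
  sets, which posterior probabilities ignore but pointwise suprema see.
\<close>

definition rb_values_supported :: "'p measure \<Rightarrow> ('p \<Rightarrow> real) \<Rightarrow> bool" where
  "rb_values_supported P m \<longleftrightarrow>
     (\<forall>\<psi>\<in>space P. \<forall>a b. a < rel_belief P m \<psi> \<and> rel_belief P m \<psi> < b \<longrightarrow>
        measure P {\<psi>' \<in> space P. a < rel_belief P m \<psi>' \<and> rel_belief P m \<psi>' < b} > 0)"

end

theory Submission
  imports Defs
begin

text \<open>
  Write \<open>RB\<close> for the relative belief ratio, \<open>h(A)\<close> for its supremum over \<open>A\<close> and \<open>\<Pi>\<close> for the
  posterior. Dividing numerator and denominator of the contaminated posterior by the prior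
  predictive density turns it into
  \<open>((1 - \<epsilon>) \<Pi>(A) + \<epsilon> a) / ((1 - \<epsilon>) + \<epsilon> (a + b))\<close>, where \<open>a\<close> and \<open>b\<close> are the integrals of \<open>RB\<close>
  with respect to \<open>Q\<close> over \<open>A\<close> and over its complement. This increases in \<open>a\<close> and decreases in \<open>b\<close>,
  and \<open>a \<le> h(A)\<close>, so the least favourable contaminations are point masses in \<open>A\<close> at which \<open>RB\<close>
  is nearly \<open>h(A)\<close>. The infimum follows by passing to the complement. With
  \<open>s(h) = (1 - \<epsilon>) / ((1 - \<epsilon>) + \<epsilon> h)\<close> the result (lemma \<open>post_range_formula\<close>) is

    \<open>\<delta>(A) = 1 - \<Pi>(A\<^sup>c) s(h(A)) - \<Pi>(A) s(h(A\<^sup>c))\<close>.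

  This expression is symmetric in \<open>A\<close> and \<open>A\<^sup>c\<close>. The mode of \<open>RB\<close> lies in one of the two, so one of
  the two heights is the maximal one. If it is \<open>h(A)\<close>, then \<open>\<delta>(A)\<close> decreases when \<open>\<Pi>(A)\<close> grows and
  when \<open>h(A\<^sup>c)\<close> falls (lemma \<open>post_range_mono\<close>), because \<open>s\<close> is antitone. A relative belief region
  is best on both counts. A set \<open>B\<close> with \<open>h(B\<^sup>c)\<close> below \<open>h(C\<^sup>c)\<close>, for \<open>C\<close> the region of credibility
  \<open>g\<close>, contains a superlevel set of \<open>RB\<close> at a level below the threshold of \<open>C\<close>, and by the
  definition of the threshold such a set has posterior content above \<open>g\<close>
  (lemma \<open>height_compl_region_le\<close>). This gives (i) when the credibility is exact, and (ii) by taking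
  complements. Without exactness the same superlevel set may have no more content than \<open>C\<close>, namely
  when \<open>RB\<close> has values just below the threshold only on a null set. The support condition rules
  this out (lemma \<open>height_compl_region_le_of_supported\<close>).

  For (iii), the sets that contain the mode are covered by (i). If \<open>A\<close> misses the mode, compare
  \<open>s\<close> with its least value, at the maximum of \<open>RB\<close>: in \<open>\<delta>(A)\<close> the excess over this value is weighted
  by \<open>1 - \<gamma>\<close>, whereas in \<open>\<delta>(C)\<close> an excess at least as large is weighted by \<open>\<gamma>\<close>. For \<open>\<gamma> \<ge> 1/2\<close>
  this makes \<open>\<delta>(C)\<close> the smaller one (lemma \<open>post_range_region_le_without_mode\<close>).
\<close>

section \<open>The posterior as a probability measure\<close>

text \<open>
  The geometry of the problem only involves the prior of \<open>\<psi>\<close> and the function \<open>m\<close>. Because the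
  relative belief ratio attains a maximum, \<open>m\<close> is bounded, and hence integrable with respect to every
  contamination.
\<close>

locale bounded_predictive = prob_space P for P :: "'p measure" +
  fixes m :: "'p \<Rightarrow> real" and mode :: 'p
  assumes m_measurable [measurable]: "m \<in> borel_measurable P"
    and m_nonneg: "\<And>\<psi>. \<psi> \<in> space P \<Longrightarrow> 0 \<le> m \<psi>"
    and mode_in: "mode \<in> space P"
    and m_le_mode: "\<And>\<psi>. \<psi> \<in> space P \<Longrightarrow> m \<psi> \<le> m mode"
    and pred_pos: "0 < predictive P m"
begin

abbreviation rb :: "'p \<Rightarrow> real" where "rb \<equiv> rel_belief P m"
abbreviation post :: "'p set \<Rightarrow> real" where "post \<equiv> posterior P m"
abbreviation region :: "real \<Rightarrow> 'p set" where "region \<equiv> rb_region P m"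

lemma rb_measurable [measurable]: "rb \<in> borel_measurable P"
  unfolding rel_belief_def [abs_def] by measurable

lemma rb_nonneg: "\<psi> \<in> space P \<Longrightarrow> 0 \<le> rb \<psi>"
  unfolding rel_belief_def using m_nonneg pred_pos by simp

lemma rb_le_mode: "\<psi> \<in> space P \<Longrightarrow> rb \<psi> \<le> rb mode"
  unfolding rel_belief_def using m_le_mode pred_pos by (simp add: divide_right_mono)

lemma m_eq_rb: "m \<psi> = predictive P m * rb \<psi>"
  unfolding rel_belief_def using pred_pos by simp

lemma integrable_m:
  assumes "prob_space Q" "sets Q = sets P"
  shows "integrable Q m"
proof -
  interpret Q: prob_space Q by fact
  have "m \<in> borel_measurable Q"
    using assms(2) m_measurable measurable_cong_sets by blast
  moreover have "\<And>\<psi>. \<psi> \<in> space Q \<Longrightarrow> norm (m \<psi>) \<le> m mode"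
    using m_nonneg m_le_mode sets_eq_imp_space_eq[OF assms(2)] by auto
  ultimately show ?thesis by (intro Q.integrable_const_bound[of _ "m mode"]) auto
qed

text \<open>
  Viewing posterior contents as values of a probability measure makes complements, monotonicity and
  continuity along monotone sequences available.
\<close>

definition posterior_measure :: "'p measure" where
  "posterior_measure = density P (\<lambda>\<psi>. ennreal (rb \<psi>))"

lemma sets_posterior_measure [simp, measurable_cong]: "sets posterior_measure = sets P"
  and space_posterior_measure [simp]: "space posterior_measure = space P"
  unfolding posterior_measure_def by simp_all

lemma integrable_rb: "integrable P rb"
  unfolding rel_belief_def [abs_def] using integrable_m[OF prob_space_axioms] by simp

lemma integral_rb: "(LINT \<psi>|P. rb \<psi>) = 1"
proof -
  have "(LINT \<psi>|P. rb \<psi>) = (LINT \<psi>|P. m \<psi>) / predictive P m"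
    unfolding rel_belief_def [abs_def] by simp
  then show ?thesis using pred_pos unfolding predictive_def by simp
qed

lemma prob_space_posterior_measure: "prob_space posterior_measure"
proof
  have "emeasure posterior_measure (space P) = (\<integral>\<^sup>+\<psi>. ennreal (rb \<psi>) \<partial>P)"
    unfolding posterior_measure_def by (simp add: emeasure_density)
  also have "\<dots> = ennreal (LINT \<psi>|P. rb \<psi>)"
    by (intro nn_integral_eq_integral integrable_rb AE_I2 rb_nonneg)
  finally show "emeasure posterior_measure (space posterior_measure) = 1"
    by (simp add: integral_rb)
qed

sublocale Post: prob_space posterior_measure
  by (rule prob_space_posterior_measure)

lemma posterior_eq_measure:
  assumes [measurable]: "A \<in> sets P"
  shows "post A = measure posterior_measure A"
proof -
  have "post A = (LINT \<psi>|P. indicator A \<psi> * rb \<psi>)"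
    unfolding posterior_def set_lebesgue_integral_def rel_belief_def by simp
  also have "\<dots> = (LINT \<psi>|P. rb \<psi> *\<^sub>R indicator A \<psi>)" by (simp add: mult.commute)
  also have "\<dots> = (LINT \<psi>|posterior_measure. indicator A \<psi>)"
    unfolding posterior_measure_def
    by (subst integral_density) (auto intro: rb_nonneg)
  also have "\<dots> = measure posterior_measure A" 
    using sets.sets_into_space[OF assms] by (simp add: Int_absorb2)
  finally show ?thesis .
qed

lemma posterior_compl: "A \<in> sets P \<Longrightarrow> post (space P - A) = 1 - post A"
  using Post.prob_compl[of A] by (simp add: posterior_eq_measure)

lemma posterior_mono: "A \<in> sets P \<Longrightarrow> B \<in> sets P \<Longrightarrow> A \<subseteq> B \<Longrightarrow> post A \<le> post B"
  using Post.finite_measure_mono[of A B] by (simp add: posterior_eq_measure)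

lemma posterior_nonneg: "A \<in> sets P \<Longrightarrow> 0 \<le> post A"
  and posterior_le_1: "A \<in> sets P \<Longrightarrow> post A \<le> 1"
  by (simp_all add: posterior_eq_measure)

section \<open>Suprema of the relative belief ratio\<close>

text \<open>
  The element \<open>0\<close> is inserted so that the empty set has height \<open>0\<close>: the extreme contaminated
  posteriors of the empty set and of the whole space then obey the same formula as all others.
  For nonempty sets nothing changes, as the ratio is nonnegative.
\<close>

definition height :: "'p set \<Rightarrow> real" where
  "height A = Sup (insert 0 (rb ` A))"

lemma height_upper: "A \<subseteq> space P \<Longrightarrow> \<psi> \<in> A \<Longrightarrow> rb \<psi> \<le> height A"
  and height_nonneg: "A \<subseteq> space P \<Longrightarrow> 0 \<le> height A"
proof -
  assume A: "A \<subseteq> space P"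
  have bdd: "bdd_above (insert 0 (rb ` A))"
    using A rb_le_mode rb_nonneg[OF mode_in] by (intro bdd_aboveI[of _ "rb mode"]) auto
  show "rb \<psi> \<le> height A" if "\<psi> \<in> A"
    unfolding height_def using bdd that by (intro cSup_upper) auto
  show "0 \<le> height A"
    unfolding height_def using bdd by (intro cSup_upper) auto
qed

lemma height_least: "0 \<le> c \<Longrightarrow> (\<And>\<psi>. \<psi> \<in> A \<Longrightarrow> rb \<psi> \<le> c) \<Longrightarrow> height A \<le> c"
  unfolding height_def by (rule cSup_least) auto

lemma height_le_mode: "A \<subseteq> space P \<Longrightarrow> height A \<le> rb mode"
  using rb_le_mode rb_nonneg[OF mode_in] by (intro height_least) auto

lemma height_eq_mode: "A \<subseteq> space P \<Longrightarrow> mode \<in> A \<Longrightarrow> height A = rb mode"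
  using height_upper height_le_mode by (metis antisym)

lemma rb_sup_eq_mode: 
  assumes "A \<subseteq> space P" "mode \<in> A" shows "rb_sup P m A = ereal (rb mode)"
  unfolding rb_sup_def
  using assms rb_le_mode by (intro antisym SUP_least SUP_upper) auto

text \<open>
  The extended-real supremum of the empty set is \<open>-\<infinity>\<close>, so a set whose supremum is the maximum is
  nonempty, and there the two notions of supremum agree.
\<close>

lemma height_eq_mode_of_rb_sup:
  assumes "A \<subseteq> space P" "rb_sup P m A = rb_sup P m (space P)"
  shows "height A = rb mode"
proof (rule antisym)
  have "ereal (rb mode) = rb_sup P m A"
    using assms rb_sup_eq_mode[OF order_refl mode_in] by simp
  also have "\<dots> \<le> ereal (height A)"
    unfolding rb_sup_def using height_upper[OF assms(1)] by (intro SUP_least) auto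
  finally show "rb mode \<le> height A" by simp
qed (rule height_le_mode[OF assms(1)])

section \<open>Relative belief regions\<close>

lemma region_measurable [measurable]: "region g \<in> sets P"
  unfolding rb_region_def by measurable

lemma posterior_sublevel_below_threshold:
  assumes "ereal k < rb_threshold P m g"
  shows "post {\<psi> \<in> space P. rb \<psi> \<le> k} < 1 - g"
  using assms unfolding rb_threshold_def
  by (metis (mono_tags, lifting) Inf_lower mem_Collect_eq not_le)

lemma threshold_le_mode:
  assumes "0 \<le> g" shows "rb_threshold P m g \<le> ereal (rb mode)"
proof -
  have "{\<psi> \<in> space P. rb \<psi> \<le> rb mode} = space P" using rb_le_mode by auto
  then have "post {\<psi> \<in> space P. rb \<psi> \<le> rb mode} \<ge> 1 - g"
    using assms Post.prob_space by (simp add: posterior_eq_measure)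
  then show ?thesis unfolding rb_threshold_def by (intro Inf_lower) auto
qed

lemma mode_in_region: "0 \<le> g \<Longrightarrow> mode \<in> region g"
  unfolding rb_region_def using mode_in threshold_le_mode by auto

lemma region_subset_space: "region g \<subseteq> space P"
  unfolding rb_region_def by auto

text \<open>
  Every level \<open>k\<close> below the threshold \<open>c\<close> has \<open>\<Pi>(RB \<le> k) < 1 - g\<close>. Letting \<open>k\<close> increase to \<open>c\<close>, the
  left limit of the distribution function of \<open>RB\<close> gives \<open>\<Pi>(RB < c) \<le> 1 - g\<close>, which is the claim
  for the complement.
\<close>

lemma posterior_region_ge:
  assumes "0 \<le> g" "g \<le> 1" shows "g \<le> post (region g)"
proof (cases "rb_threshold P m g")
  case (real c)
  let ?D = "distr posterior_measure borel rb"
  interpret D: real_distribution ?D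
    by (intro real_distribution.intro Post.prob_space_distr real_distribution_axioms.intro) auto
  have cdf: "cdf ?D k = post {\<psi> \<in> space P. rb \<psi> \<le> k}" for k
    unfolding cdf_def by (subst measure_distr) (auto simp: posterior_eq_measure intro!: arg_cong[where f="measure _"])
  have lim: "(cdf ?D \<longlongrightarrow> measure ?D {..<c}) (at_left c)" by (rule D.cdf_at_left)
  have "measure ?D {..<c} \<le> 1 - g"
  proof (rule tendsto_upperbound[OF lim])
    show "\<forall>\<^sub>F k in at_left c. cdf ?D k \<le> 1 - g"
      unfolding eventually_at_filter
      using posterior_sublevel_below_threshold[of _ g] real
      by (auto simp: cdf intro!: always_eventually less_imp_le)
  qed simp
  also have "measure ?D {..<c} = post (space P - region g)"
    by (subst measure_distr)
       (auto simp: posterior_eq_measure rb_region_def real intro!: arg_cong[where f="measure _"])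
  finally show ?thesis by (simp add: posterior_compl)
next
  case PInf
  then show ?thesis using threshold_le_mode[OF assms(1)] by simp
next
  \<comment> \<open>Only for \<open>g = 1\<close>: the region is then the whole space.\<close>
  case MInf
  then have "region g = space P" unfolding rb_region_def by auto
  then show ?thesis using assms Post.prob_space by (simp add: posterior_eq_measure)
qed

lemma height_compl_region_witness:
  assumes "B \<subseteq> space P" and "height (space P - B) < height (space P - region g)"
  obtains \<psi> where "\<psi> \<in> space P" "height (space P - B) < rb \<psi>"
    "ereal (rb \<psi>) < rb_threshold P m g"
proof -
  obtain \<psi> where "\<psi> \<in> space P - region g" "height (space P - B) < rb \<psi>"
    using assms(2) height_nonneg[of "space P - B"] height_least[of "height (space P - B)"]
    by (meson Diff_subset not_le)
  then show thesis by (intro that[of \<psi>]) (auto simp: rb_region_def)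
qed

lemma superlevel_subset:
  assumes "B \<subseteq> space P"
  shows "{\<psi> \<in> space P. height (space P - B) < rb \<psi>} \<subseteq> B"
  using height_upper[of "space P - B"] by fastforce

text \<open>
  Otherwise some \<open>\<psi>\<close> outside the region has \<open>RB\<close> above the supremum over the complement of \<open>B\<close>.
  Then \<open>B\<close> contains all points with larger \<open>RB\<close> than \<open>\<psi>\<close>, and as \<open>\<psi>\<close> is below the threshold these
  have posterior content more than \<open>g\<close>.
\<close>

lemma height_compl_region_le:
  assumes B: "B \<in> sets P" and "post B \<le> g"
  shows "height (space P - region g) \<le> height (space P - B)"
proof (rule ccontr)
  note Bsub = sets.sets_into_space[OF B]
  assume "\<not> ?thesis"
  then obtain \<psi> where \<psi>: "height (space P - B) < rb \<psi>" "ereal (rb \<psi>) < rb_threshold P m g"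
    using height_compl_region_witness[OF Bsub, of g] by (metis not_le)
  let ?L = "{\<phi> \<in> space P. rb \<phi> \<le> rb \<psi>}"
  have "space P - ?L \<subseteq> B" using superlevel_subset[OF Bsub] \<psi>(1) by fastforce
  then have "post (space P - ?L) \<le> post B" using B by (intro posterior_mono) auto
  moreover have "post ?L < 1 - g" by (rule posterior_sublevel_below_threshold) fact
  ultimately show False using \<open>post B \<le> g\<close> by (simp add: posterior_compl)
qed

lemma posterior_pos:
  assumes [measurable]: "A \<in> sets P" and "0 < measure P A" and "\<And>\<psi>. \<psi> \<in> A \<Longrightarrow> 0 < rb \<psi>"
  shows "0 < post A"
proof -
  have "post A \<noteq> 0"
  proof
    assume "post A = 0"
    then have "emeasure posterior_measure A = 0"
      by (simp add: posterior_eq_measure Post.emeasure_eq_measure)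
    then have "A \<in> null_sets posterior_measure" by (intro null_setsI) auto
    then have "AE \<psi> in P. \<psi> \<in> A \<longrightarrow> ennreal (rb \<psi>) = 0"
      unfolding posterior_measure_def by (subst (asm) null_sets_density_iff) auto
    then have "AE \<psi> in P. \<psi> \<notin> A"
    proof eventually_elim
      case (elim \<psi>)
      then show ?case using assms(3)[of \<psi>] by (auto simp: ennreal_eq_0_iff)
    qed
    then have "measure P A = 0"
      using prob_eq_0[of A] by simp
    then show False using assms(2) by simp
  qed
  then show ?thesis using posterior_nonneg[of A] by simp
qed

text \<open>
  As before, a violating \<open>B\<close> contains all points with \<open>RB\<close> above some level below the threshold.
  Besides the region these include a band of values around \<open>RB(\<psi>)\<close> that lies under the threshold.
  The band has positive prior probability by the support condition and positive posterior content
  since \<open>RB\<close> is positive on it, so \<open>B\<close> has strictly more content than the region.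
\<close>

lemma height_compl_region_le_of_supported:
  assumes supp: "rb_values_supported P m" and B: "B \<in> sets P" and le: "post B \<le> post (region g)"
  shows "height (space P - region g) \<le> height (space P - B)"
proof (rule ccontr)
  note Bsub = sets.sets_into_space[OF B]
  let ?h = "height (space P - B)"
  assume "\<not> ?thesis"
  then obtain \<psi> where \<psi>: "\<psi> \<in> space P" "?h < rb \<psi>" "ereal (rb \<psi>) < rb_threshold P m g"
    using height_compl_region_witness[OF Bsub, of g] by (metis not_le)
  obtain c where c: "rb \<psi> < c" "ereal c < rb_threshold P m g"
    using ereal_dense2[OF \<psi>(3)] by auto
  let ?S = "{\<phi> \<in> space P. ?h < rb \<phi> \<and> rb \<phi> < c}"
  have disj: "region g \<inter> ?S = {}"
    unfolding rb_region_def using c(2) by (auto dest: order.strict_trans2)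
  have sub: "region g \<union> ?S \<subseteq> B"
  proof -
    have "ereal ?h < rb_threshold P m g" using \<psi> by (meson less_ereal.simps(1) less_trans)
    then have "region g \<subseteq> {\<phi> \<in> space P. ?h < rb \<phi>}"
      unfolding rb_region_def by (auto dest: order.strict_trans2)
    then show ?thesis using superlevel_subset[OF Bsub] by blast
  qed
  have "0 < measure P ?S"
    using supp \<psi> c(1) unfolding rb_values_supported_def by blast
  then have "0 < post ?S"
    using height_nonneg[of "space P - B"] by (intro posterior_pos) auto
  then have "post (region g) < post (region g) + post ?S" by simp
  also have "\<dots> = post (region g \<union> ?S)"
    using Post.finite_measure_Union[of "region g" ?S] disj by (simp add: posterior_eq_measure)
  also have "\<dots> \<le> post B" using sub B by (intro posterior_mono) auto
  finally show False using le by simp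
qed

section \<open>The range of contaminated posteriors\<close>

text \<open>
  The fraction of the contaminated predictive density of the data that comes from the original
  prior, when the contaminating prior gives \<open>RB\<close> the mean \<open>h\<close>.
\<close>

definition share :: "real \<Rightarrow> real \<Rightarrow> real" where
  "share \<epsilon> h = (1 - \<epsilon>) / ((1 - \<epsilon>) + \<epsilon> * h)"

context
  fixes \<epsilon> :: real
  assumes eps: "0 < \<epsilon>" "\<epsilon> < 1"
begin

lemma share_antimono: "0 \<le> h \<Longrightarrow> h \<le> k \<Longrightarrow> share \<epsilon> k \<le> share \<epsilon> h"
  unfolding share_def using eps
  by (intro divide_left_mono mult_pos_pos add_pos_nonneg add_left_mono mult_left_mono) auto

lemma share_nonneg: "0 \<le> h \<Longrightarrow> 0 \<le> share \<epsilon> h"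
  unfolding share_def using eps by simp

text \<open>
  The witnesses are the integrals \<open>a\<close> and \<open>b\<close> of \<open>RB\<close> over \<open>A\<close> and over its complement under
  \<open>Q\<close>; the prior predictive density cancels.
\<close>

lemma contaminated_posterior_split:
  assumes Q: "Q \<in> contaminations P" and A: "A \<in> sets P"
  obtains a b where
    "contaminated_posterior \<epsilon> P m Q A =
      ((1 - \<epsilon>) * post A + \<epsilon> * a) / ((1 - \<epsilon>) + \<epsilon> * (a + b))"
    "contaminated_posterior \<epsilon> P m Q (space P - A) =
      ((1 - \<epsilon>) * post (space P - A) + \<epsilon> * b) / ((1 - \<epsilon>) + \<epsilon> * (a + b))"
    "0 \<le> a" "0 \<le> b" "a \<le> height A"
proof -
  let ?p = "predictive P m"
  interpret Q: prob_space Q using Q by (simp add: contaminations_def)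
  have setsQ: "sets Q = sets P" using Q by (simp add: contaminations_def)
  then have spaceQ: "space Q = space P" by (rule sets_eq_imp_space_eq)
  have intm: "integrable Q m" by (intro integrable_m Q.prob_space_axioms setsQ)
  have intrb: "integrable Q rb" unfolding rel_belief_def [abs_def] using intm by simp
  define a where "a = (LINT \<psi>:A|Q. rb \<psi>)"
  define b where "b = (LINT \<psi>:space P - A|Q. rb \<psi>)"
  have scale: "(LINT \<psi>:B|R. m \<psi>) = ?p * (LINT \<psi>:B|R. rb \<psi>)" for B R
    by (subst m_eq_rb) (rule set_integral_mult_right)
  have post: "(LINT \<psi>:B|P. m \<psi>) = ?p * post B" for B
    unfolding scale posterior_def rel_belief_def ..
  have setint: "set_integrable Q B rb" if "B \<in> sets P" for B
    unfolding set_integrable_def using intrb that setsQ by (intro integrable_mult_indicator) auto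
  have "(LINT \<psi>|Q. m \<psi>) = ?p * (LINT \<psi>:space P|Q. rb \<psi>)"
    using set_integral_space[OF intm] scale[of Q "space P"] spaceQ by simp
  also have "(LINT \<psi>:space P|Q. rb \<psi>) = (LINT \<psi>:A \<union> (space P - A)|Q. rb \<psi>)"
    using sets.sets_into_space[OF A] by (simp add: Un_absorb1)
  also have "\<dots> = a + b"
    unfolding a_def b_def using A by (intro set_integral_Un setint) auto
  finally have total: "(LINT \<psi>|Q. m \<psi>) = ?p * (a + b)" .
  have prior: "(LINT \<psi>|P. m \<psi>) = ?p" unfolding predictive_def ..
  have normalised: "contaminated_posterior \<epsilon> P m Q B =
      ((1 - \<epsilon>) * post B + \<epsilon> * (LINT \<psi>:B|Q. rb \<psi>)) / ((1 - \<epsilon>) + \<epsilon> * (a + b))" for B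
  proof -
    have "contaminated_posterior \<epsilon> P m Q B =
      (?p * ((1 - \<epsilon>) * post B + \<epsilon> * (LINT \<psi>:B|Q. rb \<psi>))) / (?p * ((1 - \<epsilon>) + \<epsilon> * (a + b)))"
      unfolding contaminated_posterior_def total post prior scale[of Q]
      by (simp add: algebra_simps)
    then show ?thesis using pred_pos by simp
  qed
  have nonneg: "0 \<le> (LINT \<psi>:B|Q. rb \<psi>)" for B
    unfolding set_lebesgue_integral_def
    by (intro integral_nonneg_AE AE_I2) (auto simp: spaceQ rb_nonneg)
  have "a \<le> height A"
    unfolding a_def set_lebesgue_integral_def
    using setint[OF A] height_upper height_nonneg sets.sets_into_space[OF A]
    by (intro Q.integral_le_const) (auto simp: set_integrable_def indicator_def)
  then show thesis
    using that[of a b] normalised nonneg unfolding a_def b_def by simp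
qed

lemma contaminated_posterior_compl:
  assumes "Q \<in> contaminations P" "A \<in> sets P"
  shows "contaminated_posterior \<epsilon> P m Q A = 1 - contaminated_posterior \<epsilon> P m Q (space P - A)"
proof -
  obtain a b where ab:
    "contaminated_posterior \<epsilon> P m Q A =
      ((1 - \<epsilon>) * post A + \<epsilon> * a) / ((1 - \<epsilon>) + \<epsilon> * (a + b))"
    "contaminated_posterior \<epsilon> P m Q (space P - A) =
      ((1 - \<epsilon>) * post (space P - A) + \<epsilon> * b) / ((1 - \<epsilon>) + \<epsilon> * (a + b))"
    "0 \<le> a" "0 \<le> b" using contaminated_posterior_split[OF assms] by metis
  have "(1 - \<epsilon>) + \<epsilon> * (a + b) > 0" using eps ab by (intro add_pos_nonneg) auto
  then show ?thesis
    unfolding ab(1,2) posterior_compl[OF assms(2)] by (simp add: field_simps)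
qed

text \<open>
  The bound is proved for the complement, whose contaminated posterior is a fraction at most \<open>1\<close>.
  Removing the common summand \<open>\<epsilon> b\<close> from numerator and denominator makes it smaller, and so does
  replacing \<open>a\<close> by the height of \<open>A\<close>.
\<close>

lemma contaminated_posterior_le:
  assumes Q: "Q \<in> contaminations P" and A: "A \<in> sets P"
  shows "contaminated_posterior \<epsilon> P m Q A \<le> 1 - post (space P - A) * share \<epsilon> (height A)"
proof -
  obtain a b where ab:
    "contaminated_posterior \<epsilon> P m Q (space P - A) =
      ((1 - \<epsilon>) * post (space P - A) + \<epsilon> * b) / ((1 - \<epsilon>) + \<epsilon> * (a + b))"
    "0 \<le> a" "0 \<le> b" "a \<le> height A" using contaminated_posterior_split[OF assms] by metis
  let ?q = "post (space P - A)" and ?d = "(1 - \<epsilon>) + \<epsilon> * a"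
  have q: "0 \<le> ?q" "?q \<le> 1" using A by (auto intro: posterior_nonneg posterior_le_1)
  have d: "0 < ?d" using eps ab by (intro add_pos_nonneg) auto
  have "?q * share \<epsilon> (height A) \<le> ?q * share \<epsilon> a"
    using ab q by (intro mult_left_mono share_antimono) auto
  also have "\<dots> = ((1 - \<epsilon>) * ?q) / ?d" unfolding share_def by simp
  also have "\<dots> \<le> ((1 - \<epsilon>) * ?q + \<epsilon> * b) / (?d + \<epsilon> * b)"
  proof -
    have "(1 - \<epsilon>) * ?q \<le> (1 - \<epsilon>) * 1" using eps q by (intro mult_left_mono) auto
    also have "\<dots> \<le> ?d" using eps ab by simp
    finally have "(1 - \<epsilon>) * ?q * (\<epsilon> * b) \<le> ?d * (\<epsilon> * b)"
      using eps ab by (intro mult_right_mono) auto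
    moreover have "0 < ?d + \<epsilon> * b" using d eps ab by (intro add_pos_nonneg) auto
    ultimately show ?thesis using d
      by (subst pos_divide_le_eq[OF d], subst times_divide_eq_left, subst pos_le_divide_eq)
         (auto simp: algebra_simps)
  qed
  also have "\<dots> = contaminated_posterior \<epsilon> P m Q (space P - A)"
    unfolding ab(1) by (simp add: algebra_simps)
  finally show ?thesis using contaminated_posterior_compl[OF assms] by simp
qed

lemma return_contamination: "\<psi> \<in> space P \<Longrightarrow> return P \<psi> \<in> contaminations P"
  unfolding contaminations_def by (simp add: prob_space_return)

text \<open>
  Point masses in \<open>A\<close> attain the upper bound with \<open>RB(\<psi>)\<close> in place of the height.
\<close>

lemma contaminated_posterior_return:
  assumes A: "A \<in> sets P" and \<psi>: "\<psi> \<in> A"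
  shows "contaminated_posterior \<epsilon> P m (return P \<psi>) A = 1 - post (space P - A) * share \<epsilon> (rb \<psi>)"
proof -
  have \<psi>P: "\<psi> \<in> space P" using A \<psi> sets.sets_into_space by blast
  have int: "(LINT \<phi>:B|return P \<psi>. m \<phi>) = indicator B \<psi> * m \<psi>" if "B \<in> sets P" for B
    unfolding set_lebesgue_integral_def using \<psi>P that by (subst integral_return) auto
  have whole: "(LINT \<phi>|return P \<psi>. m \<phi>) = m \<psi>"
    using \<psi>P by (intro integral_return) auto
  have post: "(LINT \<phi>:B|P. m \<phi>) = predictive P m * post B" for B
    unfolding posterior_def using pred_pos by simp
  have prior: "(LINT \<phi>|P. m \<phi>) = predictive P m" unfolding predictive_def ..
  have "contaminated_posterior \<epsilon> P m (return P \<psi>) (space P - A) =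
      (predictive P m * ((1 - \<epsilon>) * post (space P - A))) /
      (predictive P m * ((1 - \<epsilon>) + \<epsilon> * rb \<psi>))"
    unfolding contaminated_posterior_def whole post prior int[OF sets.compl_sets[OF A]]
    using \<psi> m_eq_rb[of \<psi>] by (simp add: algebra_simps)
  also have "\<dots> = post (space P - A) * share \<epsilon> (rb \<psi>)"
    unfolding share_def using pred_pos by simp
  finally show ?thesis
    using contaminated_posterior_compl[OF return_contamination[OF \<psi>P] A] by simp
qed

lemma SUP_contaminated_posterior:
  assumes A: "A \<in> sets P"
  shows "(SUP Q\<in>contaminations P. contaminated_posterior \<epsilon> P m Q A) =
    1 - post (space P - A) * share \<epsilon> (height A)"
proof (rule cSup_eq_non_empty)
  have P: "P \<in> contaminations P" by (simp add: contaminations_def prob_space_axioms)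
  then show "(\<lambda>Q. contaminated_posterior \<epsilon> P m Q A) ` contaminations P \<noteq> {}" by blast
  show "y \<le> 1 - post (space P - A) * share \<epsilon> (height A)"
    if "y \<in> (\<lambda>Q. contaminated_posterior \<epsilon> P m Q A) ` contaminations P" for y
    using that contaminated_posterior_le[OF _ A] by auto
  fix u assume "\<And>y. y \<in> (\<lambda>Q. contaminated_posterior \<epsilon> P m Q A) ` contaminations P \<Longrightarrow> y \<le> u"
  then have u: "contaminated_posterior \<epsilon> P m Q A \<le> u" if "Q \<in> contaminations P" for Q
    using that by blast
  let ?q = "post (space P - A)"
  note Asub = sets.sets_into_space[OF A]
  have q: "0 \<le> ?q" using A by (auto intro: posterior_nonneg)
  \<comment> \<open>Solving for \<open>h\<close> turns an upper bound for all point masses into an upper bound for their \<open>RB\<close>,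
    which then passes to the supremum without a continuity argument.\<close>
  have share_le_iff: "1 - ?q * share \<epsilon> h \<le> u \<longleftrightarrow> h \<le> (?q * (1 - \<epsilon>) / (1 - u) - (1 - \<epsilon>)) / \<epsilon>"
    if "0 \<le> h" "u < 1" for h
  proof -
    have "0 < (1 - \<epsilon>) + \<epsilon> * h" using eps that by (intro add_pos_nonneg) auto
    then have "1 - ?q * share \<epsilon> h \<le> u \<longleftrightarrow> (1 - u) * ((1 - \<epsilon>) + \<epsilon> * h) \<le> ?q * (1 - \<epsilon>)"
      unfolding share_def by (simp add: field_simps)
    also have "\<dots> \<longleftrightarrow> (1 - \<epsilon>) + \<epsilon> * h \<le> ?q * (1 - \<epsilon>) / (1 - u)"
      using that by (simp add: pos_le_divide_eq mult.commute)
    also have "\<dots> \<longleftrightarrow> h \<le> (?q * (1 - \<epsilon>) / (1 - u) - (1 - \<epsilon>)) / \<epsilon>"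
      using eps by (simp add: pos_le_divide_eq algebra_simps)
    finally show ?thesis .
  qed
  show "1 - ?q * share \<epsilon> (height A) \<le> u"
  proof (cases "u < 1")
    case False
    have "0 \<le> ?q * share \<epsilon> (height A)"
      using q share_nonneg height_nonneg[OF Asub] by simp
    then show ?thesis using False by simp
  next
    case True
    let ?B = "(?q * (1 - \<epsilon>) / (1 - u) - (1 - \<epsilon>)) / \<epsilon>"
    have bound: "rb \<psi> \<le> ?B" if "\<psi> \<in> A" for \<psi>
    proof -
      have \<psi>: "\<psi> \<in> space P" using that Asub by blast
      show ?thesis
        using u[OF return_contamination[OF \<psi>]] contaminated_posterior_return[OF A that]
          share_le_iff[OF rb_nonneg[OF \<psi>] True] by simp
    qed
    have "0 \<le> ?B"
    proof (cases "A = {}")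
      case False
      then show ?thesis using bound rb_nonneg Asub by (meson ex_in_conv order_trans subsetD)
    next
      case empty: True
      have "?q = 1" using empty Post.prob_space by (simp add: posterior_eq_measure)
      moreover have "0 \<le> u"
        using u[OF P] empty
        by (simp add: contaminated_posterior_def set_lebesgue_integral_def)
      ultimately show ?thesis using share_le_iff[of 0] True eps by (simp add: share_def)
    qed
    then have "height A \<le> ?B" using bound by (rule height_least)
    then show ?thesis using share_le_iff[OF height_nonneg[OF Asub] True] by simp
  qed
qed

text \<open>
  The supremum for \<open>A\<close> is known, and the infimum for \<open>A\<close> is one minus the supremum for the
  complement.
\<close>

lemma post_range_formula:
  assumes A: "A \<in> sets P"
  shows "post_range \<epsilon> P m A =
    1 - post (space P - A) * share \<epsilon> (height A) - post A * share \<epsilon> (height (space P - A))"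
proof -
  let ?F = "\<lambda>Q. contaminated_posterior \<epsilon> P m Q"
  have Ac: "space P - A \<in> sets P" using A by auto
  have AA: "space P - (space P - A) = A" using sets.sets_into_space[OF A] by blast
  have ne: "contaminations P \<noteq> {}"
    using prob_space_axioms by (auto simp: contaminations_def)
  have bdd: "bdd_above ((\<lambda>Q. ?F Q (space P - A)) ` contaminations P)"
    by (rule bdd_aboveI2) (rule contaminated_posterior_le[OF _ Ac])
  have "(INF Q\<in>contaminations P. ?F Q A) = (INF Q\<in>contaminations P. 1 - ?F Q (space P - A))"
    by (intro INF_cong refl contaminated_posterior_compl[OF _ A])
  also have "\<dots> = 1 - (SUP Q\<in>contaminations P. ?F Q (space P - A))"
  proof (rule cInf_eq_non_empty)
    show "(\<lambda>Q. 1 - ?F Q (space P - A)) ` contaminations P \<noteq> {}" using ne by simp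
    show "1 - (SUP Q\<in>contaminations P. ?F Q (space P - A)) \<le> y"
      if "y \<in> (\<lambda>Q. 1 - ?F Q (space P - A)) ` contaminations P" for y
      using that cSUP_upper[OF _ bdd] by auto
    fix l assume l: "\<And>y. y \<in> (\<lambda>Q. 1 - ?F Q (space P - A)) ` contaminations P \<Longrightarrow> l \<le> y"
    have "(SUP Q\<in>contaminations P. ?F Q (space P - A)) \<le> 1 - l"
      using ne l by (intro cSUP_least) force+
    then show "l \<le> 1 - (SUP Q\<in>contaminations P. ?F Q (space P - A))" by simp
  qed
  also have "\<dots> = post A * share \<epsilon> (height (space P - A))"
    unfolding SUP_contaminated_posterior[OF Ac] AA by simp
  finally show ?thesis
    unfolding post_range_def SUP_contaminated_posterior[OF A] by simp
qed

lemma post_range_compl: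
  assumes A: "A \<in> sets P"
  shows "post_range \<epsilon> P m (space P - A) = post_range \<epsilon> P m A"
proof -
  have "space P - (space P - A) = A" using sets.sets_into_space[OF A] by blast
  then show ?thesis using A by (simp add: post_range_formula)
qed

section \<open>Optimality of relative belief regions\<close>

text \<open>
  With \<open>s\<close> the share at the maximal height, \<open>\<delta>(A) = 1 - s - \<Pi>(A) (share(h(A\<^sup>c)) - s)\<close>, and both
  factors of the product are nonnegative.
\<close>

lemma post_range_mono:
  assumes A: "A \<in> sets P" "height A = rb mode" and B: "B \<in> sets P" "height B = rb mode"
    and le: "post B \<le> post A" "height (space P - A) \<le> height (space P - B)"
  shows "post_range \<epsilon> P m A \<le> post_range \<epsilon> P m B"
proof -
  let ?s = "share \<epsilon> (rb mode)"
  let ?a = "share \<epsilon> (height (space P - A))" and ?b = "share \<epsilon> (height (space P - B))"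
  have b: "?s \<le> ?b" "?b \<le> ?a"
    using le by (auto intro!: share_antimono height_le_mode height_nonneg)
  have "post B * (?b - ?s) \<le> post A * (?a - ?s)"
    using le b posterior_nonneg[OF A(1)] by (intro mult_mono) auto
  then show ?thesis
    using A B by (simp add: post_range_formula posterior_compl algebra_simps)
qed

lemma post_range_region_le:
  assumes "0 \<le> g" "g \<le> 1" "B \<in> sets P" "post B \<le> g" "height B = rb mode"
  shows "post_range \<epsilon> P m (region g) \<le> post_range \<epsilon> P m B"
  using assms posterior_region_ge[of g] height_compl_region_le[of B g]
    height_eq_mode[OF region_subset_space mode_in_region]
  by (intro post_range_mono) auto

text \<open>
  The complement of \<open>A\<close> has content \<open>1 - g \<le> g\<close>, so among sets with content at most \<open>g\<close> it competes
  with the region, and therefore \<open>h(A)\<close> is at least the height of the complement of the region.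
  With \<open>s\<close> the share at the maximal height, \<open>1 - s - \<delta>\<close> is \<open>(1 - g)\<close> times a
  nonnegative gain for \<open>A\<close> and \<open>g\<close> times a gain at least as large for the region.
\<close>

lemma post_range_region_le_without_mode:
  assumes g: "1 / 2 \<le> g" "g \<le> 1" and exact: "post (region g) = g"
    and A: "A \<in> sets P" "post A = g" "height (space P - A) = rb mode"
  shows "post_range \<epsilon> P m (region g) \<le> post_range \<epsilon> P m A"
proof -
  let ?s = "share \<epsilon> (rb mode)"
  let ?a = "share \<epsilon> (height A)" and ?c = "share \<epsilon> (height (space P - region g))"
  note Asub = sets.sets_into_space[OF A(1)]
  have "height (space P - region g) \<le> height (space P - (space P - A))"
    using A g by (intro height_compl_region_le) (auto simp: posterior_compl)
  also have "space P - (space P - A) = A" using Asub by blast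
  finally have "?s \<le> ?a" "?a \<le> ?c"
    using Asub by (auto intro!: share_antimono height_le_mode height_nonneg)
  then have "(1 - g) * (?a - ?s) \<le> g * (?c - ?s)"
    using g by (intro mult_mono) auto
  then show ?thesis
    using A exact height_eq_mode[OF region_subset_space mode_in_region[of g]] g
    by (simp add: post_range_formula posterior_compl algebra_simps)
qed

end

end

section \<open>The Bayesian model\<close>

text \<open>
  Measurability of \<open>m\<close> in \<open>\<psi>\<close> comes from the conditional priors forming a Markov kernel.
\<close>

lemma bounded_predictive_of_model:
  assumes model: "bayes_model \<mu> \<nu> N f \<pi> \<Psi> K"
    and data: "x \<in> space \<mu>"
    and P_eq: "P = marginal_prior \<nu> \<pi> \<Psi> N"
    and m_eq: "m = cond_predictive f K x"
    and pos: "0 < predictive P m"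
    and mode: "mode \<in> space P" "\<And>\<psi>. \<psi> \<in> space P \<Longrightarrow> rel_belief P m \<psi> \<le> rel_belief P m mode"
  shows "bounded_predictive P m mode"
proof -
  interpret bayes_model \<mu> \<nu> N f \<pi> \<Psi> K by fact
  note [measurable] = prior_measurable param_measurable
  have setsP [simp, measurable_cong]: "sets P = sets N"
    unfolding P_eq marginal_prior_def by simp
  have spaceP: "space P = space N" by (rule sets_eq_imp_space_eq) simp
  have "prob_space (prior \<nu> \<pi>)"
    by rule (simp add: prior_def emeasure_density prior_density)
  then have probP: "prob_space P"
    unfolding P_eq marginal_prior_def by (rule prob_space.prob_space_distr) (simp add: prior_def)
  have fx: "(\<lambda>\<theta>. f \<theta> x) \<in> borel_measurable \<nu>"
    using measurable_compose[OF measurable_Pair2'[OF data] model_measurable] by simp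
  have setsK: "sets (K \<psi>) = sets \<nu>" if "\<psi> \<in> space N" for \<psi>
    using measurable_space[OF kernel that] by (simp add: space_prob_algebra)
  have spaceK: "space (K \<psi>) = space \<nu>" if "\<psi> \<in> space N" for \<psi>
    using setsK[OF that] by (rule sets_eq_imp_space_eq)
  have nonneg: "0 \<le> m \<psi>" if "\<psi> \<in> space N" for \<psi>
    unfolding m_eq cond_predictive_def
    using model_nonneg data spaceK[OF that] by (intro integral_nonneg_AE AE_I2) auto
  have m_nn: "m \<psi> = enn2real (\<integral>\<^sup>+ \<theta>. ennreal (f \<theta> x) \<partial>K \<psi>)" if "\<psi> \<in> space N" for \<psi>
    unfolding m_eq cond_predictive_def
  proof (rule integral_eq_nn_integral)
    show "(\<lambda>\<theta>. f \<theta> x) \<in> borel_measurable (K \<psi>)"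
      using fx measurable_cong_sets[OF setsK[OF that] refl] by blast
  qed (use model_nonneg data spaceK[OF that] in auto)
  have nn: "(\<lambda>\<psi>. \<integral>\<^sup>+ \<theta>. ennreal (f \<theta> x) \<partial>K \<psi>) \<in> borel_measurable N"
    using measurable_compose[OF measurable_prob_algebraD[OF kernel]
        nn_integral_measurable_subprob_algebra[of "\<lambda>\<theta>. ennreal (f \<theta> x)"]] fx by simp
  have "m \<in> borel_measurable N"
    using nn by (subst measurable_cong[OF m_nn]) simp_all
  then have "m \<in> borel_measurable P" by simp
  moreover have "m \<psi> \<le> m mode" if "\<psi> \<in> space P" for \<psi>
    using mode(2)[OF that] pos unfolding rel_belief_def by (simp add: divide_le_cancel)
  ultimately show ?thesis
    using probP nonneg mode(1) pos
    by (intro bounded_predictive.intro bounded_predictive_axioms.intro) (auto simp: spaceP)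
qed

theorem proposition2:
  fixes \<mu> :: "'x measure" and \<nu> :: "'t measure" and N P :: "'p measure"
    and f :: "'t \<Rightarrow> 'x \<Rightarrow> real" and \<pi> :: "'t \<Rightarrow> real"
    and \<Psi> :: "'t \<Rightarrow> 'p" and K :: "'p \<Rightarrow> 't measure"
    and x :: 'x and m :: "'p \<Rightarrow> real" and \<epsilon> \<gamma> \<gamma>' :: real
  assumes model: "bayes_model \<mu> \<nu> N f \<pi> \<Psi> K"
    and data: "x \<in> space \<mu>"
    and P_eq: "P = marginal_prior \<nu> \<pi> \<Psi> N"
    and m_eq: "m = cond_predictive f K x"
    and m_finite: "\<And>\<psi>. \<psi> \<in> space N \<Longrightarrow> integrable (K \<psi>) (\<lambda>\<theta>. f \<theta> x)"
    and predictive_pos: "0 < predictive P m"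
    and unique_max:
      "\<exists>!\<psi>. \<psi> \<in> space P \<and> (\<forall>\<psi>'\<in>space P. rel_belief P m \<psi>' \<le> rel_belief P m \<psi>)"
    and eps: "0 < \<epsilon>" "\<epsilon> < 1"
    and gamma: "0 \<le> \<gamma>" "\<gamma> \<le> 1"
    and gamma'_eq: "\<gamma>' = posterior P m (rb_region P m \<gamma>)"
  shows
    "(\<gamma>' = \<gamma> \<or> rb_values_supported P m \<longrightarrow>
        is_arg_min (post_range \<epsilon> P m)
          (\<lambda>A. A \<in> sets P \<and> posterior P m A \<le> \<gamma>' \<and> rb_sup P m A = rb_sup P m (space P))
          (rb_region P m \<gamma>)) \<and>
     ((\<forall>A\<in>sets P. posterior P m A \<ge> \<gamma>' \<and> rb_sup P m (space P - A) = rb_sup P m (space P) \<longrightarrow>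
          post_range \<epsilon> P m (space P - rb_region P m (1 - \<gamma>')) \<le> post_range \<epsilon> P m A) \<and>
      rb_sup P m (space P - (space P - rb_region P m (1 - \<gamma>'))) = rb_sup P m (space P) \<and>
      (posterior P m (rb_region P m (1 - \<gamma>')) = 1 - \<gamma>' \<longrightarrow>
        is_arg_min (post_range \<epsilon> P m)
          (\<lambda>A. A \<in> sets P \<and> posterior P m A \<ge> \<gamma>' \<and>
               rb_sup P m (space P - A) = rb_sup P m (space P))
          (space P - rb_region P m (1 - \<gamma>')))) \<and>
     (\<gamma>' = \<gamma> \<and> \<gamma> \<ge> 1 / 2 \<longrightarrow>
        is_arg_min (post_range \<epsilon> P m)
          (\<lambda>A. A \<in> sets P \<and> posterior P m A = \<gamma>)
          (rb_region P m \<gamma>))"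
proof -
  let ?S = "space P" and ?C = "rb_region P m \<gamma>" and ?D = "rb_region P m (1 - \<gamma>')"
  let ?\<delta> = "post_range \<epsilon> P m"
  obtain mode where mode: "mode \<in> ?S"
    "\<And>\<psi>. \<psi> \<in> ?S \<Longrightarrow> rel_belief P m \<psi> \<le> rel_belief P m mode"
    using unique_max by blast
  interpret bounded_predictive P m mode
    using bounded_predictive_of_model[OF model data P_eq m_eq predictive_pos mode] .
  have gamma': "0 \<le> \<gamma>'" "\<gamma>' \<le> 1"
    unfolding gamma'_eq by (simp_all add: posterior_nonneg posterior_le_1)
  have region_height: "height (region g) = rb mode"
    and region_rb_sup: "rb_sup P m (region g) = rb_sup P m ?S" if "0 \<le> g" for g
    using that mode(1)
    by (simp_all add: height_eq_mode rb_sup_eq_mode region_subset_space mode_in_region)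
  have SD: "?S - (?S - ?D) = ?D" using region_subset_space by blast

  have i: "is_arg_min ?\<delta>
      (\<lambda>A. A \<in> sets P \<and> post A \<le> \<gamma>' \<and> rb_sup P m A = rb_sup P m ?S) ?C"
    if "\<gamma>' = \<gamma> \<or> rb_values_supported P m"
    unfolding is_arg_min_linorder
  proof (intro conjI allI impI)
    fix A assume A: "A \<in> sets P \<and> post A \<le> \<gamma>' \<and> rb_sup P m A = rb_sup P m ?S"
    then have "height (?S - ?C) \<le> height (?S - A)"
      using that height_compl_region_le[of A \<gamma>] height_compl_region_le_of_supported[of A \<gamma>]
      unfolding gamma'_eq by auto
    then show "?\<delta> ?C \<le> ?\<delta> A"
      using A gamma(1) region_height height_eq_mode_of_rb_sup[OF sets.sets_into_space]
      by (intro post_range_mono eps) (auto simp: gamma'_eq)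
  qed (use gamma(1) gamma'_eq region_rb_sup in auto)

  have ii: "?\<delta> (?S - ?D) \<le> ?\<delta> A"
    if A: "A \<in> sets P" "post A \<ge> \<gamma>'" "rb_sup P m (?S - A) = rb_sup P m ?S" for A
  proof -
    have "?\<delta> ?D \<le> ?\<delta> (?S - A)"
      using A gamma' height_eq_mode_of_rb_sup[OF Diff_subset A(3)]
      by (intro post_range_region_le eps) (auto simp: posterior_compl)
    then show ?thesis using A(1) by (simp add: post_range_compl[OF eps])
  qed
  have ii_rb_sup: "rb_sup P m (?S - (?S - ?D)) = rb_sup P m ?S"
    unfolding SD using gamma' by (intro region_rb_sup) simp
  have ii_arg_min: "is_arg_min ?\<delta>
      (\<lambda>A. A \<in> sets P \<and> post A \<ge> \<gamma>' \<and> rb_sup P m (?S - A) = rb_sup P m ?S) (?S - ?D)"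
    if "post ?D = 1 - \<gamma>'"
    unfolding is_arg_min_linorder using ii ii_rb_sup that by (auto simp: posterior_compl)

  have iii: "is_arg_min ?\<delta> (\<lambda>A. A \<in> sets P \<and> post A = \<gamma>) ?C"
    if exact: "\<gamma>' = \<gamma>" "\<gamma> \<ge> 1 / 2"
    unfolding is_arg_min_linorder
  proof (intro conjI allI impI)
    fix A assume A: "A \<in> sets P \<and> post A = \<gamma>"
    then have Asub: "A \<subseteq> ?S" using sets.sets_into_space by blast
    show "?\<delta> ?C \<le> ?\<delta> A"
    proof (cases "mode \<in> A")
      case True
      then show ?thesis
        using A gamma height_eq_mode[OF Asub] by (intro post_range_region_le eps) auto
    next
      case False
      then have "height (?S - A) = rb mode" using mode(1) by (intro height_eq_mode) auto
      then show ?thesis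
        using A gamma exact gamma'_eq by (intro post_range_region_le_without_mode eps) auto
    qed
  qed (use exact gamma'_eq in auto)

  show ?thesis using i ii ii_rb_sup ii_arg_min iii by blast
qed

end
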